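(* Let $m$ be a positive integer and let $S$ be a numerical semigroup with multiplicity $m$. Define sets of numerical semigroups recursively by $B_0 = \{S\}$ and $$B_{n+1} = \bigcup_{S' \in B_n} \{S' \cup \{x\} : x \in \mathrm{SG}(S'),\ x > m\} \qquad (n \ge 0).$$ Then $B_n = \emptyset$ for some $n$ (so the procedure that computes $B_0, B_1, B_2, \ldots$ until an empty set is reached terminates), and $\bigcup_{n \ge 0} B_n = \mathcal{O}_m(S)$.
   Context: $\mathbb{N}$ denotes the set of nonnegative integers. A numerical semigroup is a subset $S \subseteq \mathbb{N}$ closed under addition, containing $0$, and such that $\mathbb{N}\setminus S$ is finite. The multiplicity of $S$ is the least positive integer belonging to $S$. $\mathcal{S}(m)$ denotes the set of numerical semigroups with multiplicity $m$. For $S \in \mathcal{S}(m)$, $\mathcal{O}_m(S) = \{S' \in \mathcal{S}(m) : S \subseteq S'\}$ is the set of oversemigroups of $S$ with multiplicity $m$. For a numerical semigroup $T$, the set of special gaps of $T$ is $\mathrm{SG}(T) = \{x \in \mathbb{N}\setminus T : T \cup \{x\} \text{ is a numerical semigroup}\}$. *)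

theory Defs
  imports Main
begin

definition numerical_semigroup :: "nat set \<Rightarrow> bool" where
  "numerical_semigroup S \<longleftrightarrow>
     0 \<in> S \<and> (\<forall>x\<in>S. \<forall>y\<in>S. x + y \<in> S) \<and> finite (UNIV - S)"

(* A numerical semigroup is cofinite, so it contains a positive integer and LEAST is meaningful. *)
definition semigroup_multiplicity :: "nat set \<Rightarrow> nat" where
  "semigroup_multiplicity S = (LEAST n. 0 < n \<and> n \<in> S)"

definition semigroups_of_multiplicity :: "nat \<Rightarrow> nat set set" where
  "semigroups_of_multiplicity m =
     {S. numerical_semigroup S \<and> semigroup_multiplicity S = m}"

definition oversemigroups :: "nat \<Rightarrow> nat set \<Rightarrow> nat set set" where
  "oversemigroups m S = {S' \<in> semigroups_of_multiplicity m. S \<subseteq> S'}"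

definition special_gaps :: "nat set \<Rightarrow> nat set" where
  "special_gaps T = {x \<in> UNIV - T. numerical_semigroup (T \<union> {x})}"

primrec oversemigroup_level :: "nat \<Rightarrow> nat set \<Rightarrow> nat \<Rightarrow> nat set set" where
  "oversemigroup_level m S 0 = {S}"
| "oversemigroup_level m S (Suc n) =
     (\<Union>S'\<in>oversemigroup_level m S n. {S' \<union> {x} | x. x \<in> special_gaps S' \<and> x > m})"

end

(* If S' is a proper subsemigroup of T, the largest element x of T - S' is a special gap of S':
   every sum involving x and a positive element of S' \<union> {x} lies in T and exceeds x, hence lies
   in S'. Adding such elements one at a time leads from S to any oversemigroup of the same
   multiplicity. Each step removes one of the finitely many gaps of S, so the levels eventually
   become empty. *)
theory Submission
  imports Defs
begin

text \<open>Since T is cofinite, it stays infinite after 0 is removed, so the \<open>LEAST\<close>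
  is attained by a positive element. Trading \<open>LEAST\<close> for explicit minimality makes it
  immediate that adjoining an element above m keeps the multiplicity.\<close>

lemma semigroups_of_multiplicity_iff:
  "T \<in> semigroups_of_multiplicity m \<longleftrightarrow>
     numerical_semigroup T \<and> 0 < m \<and> m \<in> T \<and> (\<forall>y\<in>T. 0 < y \<longrightarrow> m \<le> y)"
proof
  assume T: "T \<in> semigroups_of_multiplicity m"
  then have ns: "numerical_semigroup T" and m: "m = (LEAST n. 0 < n \<and> n \<in> T)"
    by (auto simp: semigroups_of_multiplicity_def semigroup_multiplicity_def)
  have "infinite (UNIV - (UNIV - T))"
    using ns by (intro Diff_infinite_finite) (auto simp: numerical_semigroup_def)
  then have "infinite (T - {0})"
    by (simp add: double_diff)
  then have "T - {0} \<noteq> {}"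
    by (rule infinite_imp_nonempty)
  then obtain k where "k \<in> T - {0}"
    by blast
  then have "k > 0" "k \<in> T"
    by auto
  then have "0 < m \<and> m \<in> T"
    unfolding m by (intro LeastI[where P = "\<lambda>n. 0 < n \<and> n \<in> T"]) simp
  moreover have "\<forall>y\<in>T. 0 < y \<longrightarrow> m \<le> y"
    unfolding m by (auto intro: Least_le)
  ultimately show "numerical_semigroup T \<and> 0 < m \<and> m \<in> T \<and> (\<forall>y\<in>T. 0 < y \<longrightarrow> m \<le> y)"
    using ns by blast
next
  assume "numerical_semigroup T \<and> 0 < m \<and> m \<in> T \<and> (\<forall>y\<in>T. 0 < y \<longrightarrow> m \<le> y)"
  then show "T \<in> semigroups_of_multiplicity m"
    by (auto simp: semigroups_of_multiplicity_def semigroup_multiplicity_def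
        intro!: Least_equality)
qed

lemma Max_diff_special_gap:
  assumes T': "numerical_semigroup T'" and T: "numerical_semigroup T" and "T' \<subset> T"
  shows "Max (T - T') \<in> special_gaps T'"
proof -
  define x where "x = Max (T - T')"
  have fin: "finite (T - T')"
    using T' by (auto simp: numerical_semigroup_def intro: finite_subset[of _ "UNIV - T'"])
  have x: "x \<in> T - T'"
    unfolding x_def using fin \<open>T' \<subset> T\<close> by (intro Max_in) auto
  \<comment> \<open>An element of T beyond the maximum x of T - T' cannot itself lie in T -
    T'.\<close>
  have above: "y \<in> T'" if "y \<in> T" "x < y" for y
    using Max_ge[OF fin, of y] that unfolding x_def by fastforce
  \<comment> \<open>The case s = 0 is separate because x + 0 does not exceed x. For s > 0 the
    argument also covers s = x, that is, the sum x + x.\<close>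
  have sum: "x + s \<in> T' \<union> {x}" if "s \<in> T' \<union> {x}" for s
  proof (cases "s = 0")
    case False
    have "x + s \<in> T"
      using T x that \<open>T' \<subset> T\<close> by (auto simp: numerical_semigroup_def)
    then show ?thesis
      using above False by simp
  qed simp
  then have "s + x \<in> T' \<union> {x}" if "s \<in> T' \<union> {x}" for s
    using that by (simp add: add.commute)
  moreover have "s + t \<in> T'" if "s \<in> T'" "t \<in> T'" for s t
    using T' that by (auto simp: numerical_semigroup_def)
  moreover have "finite (UNIV - (T' \<union> {x}))"
    using T' by (auto simp: numerical_semigroup_def intro: finite_subset[of _ "UNIV - T'"])
  ultimately have "numerical_semigroup (T' \<union> {x})"
    using T' sum unfolding numerical_semigroup_def by blast
  then show ?thesis
    using x unfolding special_gaps_def x_def by blast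
qed

lemma union_gap_multiplicity:
  assumes "T \<in> semigroups_of_multiplicity m" "x \<in> special_gaps T" "x > m"
  shows "T \<union> {x} \<in> semigroups_of_multiplicity m"
  using assms by (auto simp: semigroups_of_multiplicity_iff special_gaps_def)

text \<open>Each step fills exactly one gap, so the level index counts the gaps of S filled so far.
  The cardinality equation therefore bounds the index of a nonempty level, which gives
  termination.\<close>

lemma oversemigroup_level_sound:
  assumes "S \<in> semigroups_of_multiplicity m" "T \<in> oversemigroup_level m S n"
  shows "T \<in> oversemigroups m S \<and> card (UNIV - T) + n = card (UNIV - S)"
  using assms(2)
proof (induction n arbitrary: T)
  case 0
  then show ?case
    using assms(1) by (simp add: oversemigroups_def)
next
  case (Suc n)
  then obtain T' x where T': "T' \<in> oversemigroup_level m S n"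
    and x: "x \<in> special_gaps T'" "x > m" and T: "T = T' \<union> {x}"
    by auto
  have IH: "T' \<in> oversemigroups m S" "card (UNIV - T') + n = card (UNIV - S)"
    using Suc.IH[OF T'] by auto
  then have "finite (UNIV - T')"
    by (auto simp: oversemigroups_def semigroups_of_multiplicity_def numerical_semigroup_def)
  moreover have "UNIV - T = (UNIV - T') - {x}" "x \<in> UNIV - T'"
    using x T by (auto simp: special_gaps_def)
  ultimately have "card (UNIV - T') = Suc (card (UNIV - T))"
    by (metis card_Suc_Diff1)
  then show ?case
    using IH union_gap_multiplicity[OF _ x] T by (auto simp: oversemigroups_def)
qed

text \<open>The starting point is an arbitrary T' at an arbitrary level, rather than S at level 0,
  so that the induction on \<open>card (T - T')\<close> can restart from T' \<union> {x} one level
  higher.\<close>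

lemma oversemigroup_level_reaches:
  assumes "T \<in> semigroups_of_multiplicity m" "T' \<in> semigroups_of_multiplicity m"
    and "T' \<subseteq> T" "T' \<in> oversemigroup_level m S n"
  shows "\<exists>k. T \<in> oversemigroup_level m S k"
  using assms(2-4)
proof (induction "card (T - T')" arbitrary: T' n rule: less_induct)
  case less
  show ?case
  proof (cases "T' = T")
    case True
    then show ?thesis
      using less.prems by blast
  next
    case False
    define x where "x = Max (T - T')"
    have fin: "finite (T - T')"
      using less.prems(1)
      by (auto simp: semigroups_of_multiplicity_iff numerical_semigroup_def
          intro: finite_subset[of _ "UNIV - T'"])
    have x: "x \<in> T - T'"
      unfolding x_def using fin False less.prems(2) by (intro Max_in) auto
    have gap: "x \<in> special_gaps T'"
      unfolding x_def using assms(1) less.prems False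
      by (intro Max_diff_special_gap) (auto simp: semigroups_of_multiplicity_iff)
    \<comment> \<open>The side condition x > m of the procedure holds because x is an element of T
      other than 0 and m, and positive elements of T are at least m.\<close>
    have "0 \<in> T'" "m \<in> T'"
      using less.prems(1)
      by (auto simp: semigroups_of_multiplicity_iff numerical_semigroup_def)
    then have "x \<noteq> 0" "x \<noteq> m"
      using x by (metis DiffD2)+
    then have "x > m"
      using x assms(1) by (force simp: semigroups_of_multiplicity_iff)
    have "card (T - (T' \<union> {x})) < card (T - T')"
      using fin x by (intro psubset_card_mono) auto
    then show ?thesis
    proof (rule less.hyps)
      show "T' \<union> {x} \<in> semigroups_of_multiplicity m"
        using union_gap_multiplicity less.prems(1) gap \<open>x > m\<close> by blast
      show "T' \<union> {x} \<subseteq> T"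
        using x less.prems(2) by blast
      show "T' \<union> {x} \<in> oversemigroup_level m S (Suc n)"
        using less.prems(3) gap \<open>x > m\<close> by auto
    qed
  qed
qed

theorem mainTheorem4:
  fixes m :: nat and S :: "nat set"
  assumes "0 < m"
    and "S \<in> semigroups_of_multiplicity m"
  shows "(\<exists>n. oversemigroup_level m S n = {}) \<and>
         (\<Union>n. oversemigroup_level m S n) = oversemigroups m S"
proof
  \<comment> \<open>A member at this level would have filled one more gap than S has.\<close>
  have "oversemigroup_level m S (Suc (card (UNIV - S))) = {}"
    using oversemigroup_level_sound[OF assms(2), of _ "Suc (card (UNIV - S))"] by fastforce
  then show "\<exists>n. oversemigroup_level m S n = {}" ..
  have "\<exists>n. T \<in> oversemigroup_level m S n" if "T \<in> oversemigroups m S" for T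
    using oversemigroup_level_reaches[of T m S S 0] that assms(2)
    by (simp add: oversemigroups_def)
  then show "(\<Union>n. oversemigroup_level m S n) = oversemigroups m S"
    using oversemigroup_level_sound[OF assms(2)] by (intro set_eqI) (simp, metis)
qed

end
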